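(* There are infinitely many pairs of non-isomorphic graphs $(G,G')$ such that $G$ and $G'$ have identical transition $q$-spectra, identical $q$-spectra, and identical formal magnitudes.
   Context: Graphs are finite, connected, undirected and simple. The vertex set $\{x_1,\dots,x_n\}$ of a graph is regarded as a finite metric space with $d_{ij}=d(x_i,x_j)$ the length of a shortest path between $x_i$ and $x_j$. "Infinitely many pairs" is meant up to isomorphism. Let $q$ be a formal parameter (equivalently, $q$ ranges over real numbers in $(0,1)$). The similarity matrix is $Z(q)=(q^{d_{ij}})_{i,j}$. The $q$-spectrum is the multiset of eigenvalues of $Z(q)$. With $\pi_i=\sum_{j=1}^n q^{d_{ij}}$, the transition similarity matrix is $P(q)=(q^{d_{ij}}/\pi_i)_{i,j}$, and the transition $q$-spectrum is the multiset of eigenvalues of $P(q)$. Two graphs have identical ($q$- or transition $q$-) spectra if the corresponding multisets agree for all $q\in(0,1)$; equivalently, the corresponding characteristic polynomials coincide. The formal magnitude is the sum of all entries of $Z(q)^{-1}$, the inverse being taken over the field of fractions of the ring of generalized polynomials in $q$ (real exponents allowed; for graphs, ordinary rational functions of $q$). *)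

theory Defs
  imports
    "Graph_Theory.Graph_Theory"
    "Jordan_Normal_Form.Char_Poly"
    "Jordan_Normal_Form.Gauss_Jordan_Elimination"
    "HOL-Computational_Algebra.Computational_Algebra"
begin

text \<open>
  A simple undirected graph is a \<^locale>\<open>pair_graph\<close>: finite, loop-free, with a symmetric
  set of ordered pairs as arcs. Connectedness of the library excludes the empty graph.
\<close>

definition connected_graph :: "'a pair_pre_digraph \<Rightarrow> bool" where
  "connected_graph G \<longleftrightarrow> pair_graph G \<and> Digraph_Component.connected (with_proj G)"

definition graph_iso :: "'a pair_pre_digraph \<Rightarrow> 'b pair_pre_digraph \<Rightarrow> bool" where
  "graph_iso G H \<longleftrightarrow> digraph_iso (with_proj G) (with_proj H)"

definition iso_class :: "'a pair_pre_digraph \<Rightarrow> 'a pair_pre_digraph set" where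
  "iso_class G = {H. connected_graph H \<and> graph_iso G H}"

definition graph_dist :: "'a pair_pre_digraph \<Rightarrow> 'a \<Rightarrow> 'a \<Rightarrow> nat" where
  "graph_dist G u v = (LEAST k. \<exists>p. pre_digraph.apath (with_proj G) u p v \<and> length p = k)"

text \<open>
  Matrices are indexed by positions in the increasing enumeration of the vertex set. Both
  matrices are defined over an arbitrary field, so that \<open>q\<close> may be a number or
  an indeterminate.
\<close>

definition vertex :: "'a::linorder pair_pre_digraph \<Rightarrow> nat \<Rightarrow> 'a" where
  "vertex G i = sorted_list_of_set (pverts G) ! i"

definition similarity_matrix :: "'a::linorder pair_pre_digraph \<Rightarrow> 'k::field \<Rightarrow> 'k mat" where
  "similarity_matrix G q = mat (card (pverts G)) (card (pverts G))
     (\<lambda>(i, j). q ^ graph_dist G (vertex G i) (vertex G j))"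

definition transition_matrix :: "'a::linorder pair_pre_digraph \<Rightarrow> 'k::field \<Rightarrow> 'k mat" where
  "transition_matrix G q = mat (card (pverts G)) (card (pverts G))
     (\<lambda>(i, j). q ^ graph_dist G (vertex G i) (vertex G j) /
        (\<Sum>l<card (pverts G). q ^ graph_dist G (vertex G i) (vertex G l)))"

text \<open>
  The eigenvalues with algebraic multiplicity. They are taken over the complex numbers, so
  that the multiset always has as many elements as the matrix has rows.
\<close>

definition eigenvalue_mset :: "complex mat \<Rightarrow> complex multiset" where
  "eigenvalue_mset A = proots (char_poly A)"

definition q_spectrum :: "'a::linorder pair_pre_digraph \<Rightarrow> real \<Rightarrow> complex multiset" where
  "q_spectrum G q = eigenvalue_mset (similarity_matrix G (complex_of_real q))"

definition transition_q_spectrum :: "'a::linorder pair_pre_digraph \<Rightarrow> real \<Rightarrow> complex multiset" where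
  "transition_q_spectrum G q = eigenvalue_mset (transition_matrix G (complex_of_real q))"

definition identical_q_spectra ::
    "'a::linorder pair_pre_digraph \<Rightarrow> 'b::linorder pair_pre_digraph \<Rightarrow> bool" where
  "identical_q_spectra G H \<longleftrightarrow> (\<forall>q\<in>{0<..<1}. q_spectrum G q = q_spectrum H q)"

definition identical_transition_q_spectra ::
    "'a::linorder pair_pre_digraph \<Rightarrow> 'b::linorder pair_pre_digraph \<Rightarrow> bool" where
  "identical_transition_q_spectra G H \<longleftrightarrow>
     (\<forall>q\<in>{0<..<1}. transition_q_spectrum G q = transition_q_spectrum H q)"

text \<open>
  Distances in graphs are natural numbers, so ordinary rational functions suffice. The
  \<^const>\<open>the\<close> is harmless: at \<open>q = 0\<close> the similarity matrix is the identity, hence it is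
  invertible over the field of rational functions.
\<close>

definition formal_magnitude :: "'a::linorder pair_pre_digraph \<Rightarrow> real poly fract" where
  "formal_magnitude G = sum_mat (the (mat_inverse (similarity_matrix G (to_fract [:0, 1:]))))"

end

theory Submission
  imports Defs
begin

text \<open>
  Godsil--McKay switching. Let \<open>C\<close> be a set of four independent vertices such that every other
  vertex is adjacent to none, two or all of them, and let \<open>G'\<close> arise from \<open>G\<close> by exchanging
  neighbours and non-neighbours in \<open>C\<close> of the vertices with two neighbours there. If some vertex
  is adjacent to all others, distances are at most 2, so the exchange affects \<open>q\<close> and \<open>q\<^sup>2\<close> only,
  and \<open>S Z = Z' S\<close> for the involution \<open>S\<close> that is \<open>J / 2 - I\<close> on \<open>C\<close> and the identity elsewhere.
  Since \<open>S\<close> fixes the all-ones vector, the magnitudes agree; since the row sums of \<open>Z\<close>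
  are constant on \<open>C\<close> and survive the switching, \<open>S\<close> also conjugates the transition matrices.
  Pendant vertices attached to the dominating vertex make the family infinite.
\<close>

section \<open>Graphs with a dominating vertex\<close>

lemma dominating_vertex_connected:
  assumes "pair_graph G" "w \<in> pverts G"
    and "\<And>v. v \<in> pverts G \<Longrightarrow> v \<noteq> w \<Longrightarrow> (v, w) \<in> parcs G"
  shows "connected_graph G"
proof -
  interpret pair_graph G by fact
  have "v \<rightarrow>\<^sup>*\<^bsub>with_proj G\<^esub> w" if "v \<in> pverts G" for v
    using assms(2,3) that by (cases "v = w") (auto intro!: reachable_adjI)
  moreover have "w \<rightarrow>\<^sup>*\<^bsub>with_proj G\<^esub> v" if "v \<in> pverts G" for v
    using assms(2,3) that by (cases "v = w") (auto intro!: reachable_adjI dest: arcs_symmetric)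
  \<comment> \<open>Library connectedness is strong connectedness of the symmetric closure, so
    reachability through \<open>w\<close> is lifted to that closure.\<close>
  ultimately have "u \<rightarrow>\<^sup>*\<^bsub>mk_symmetric (with_proj G)\<^esub> v" if "u \<in> pverts G" "v \<in> pverts G" for u v
    using that by (blast intro: reachable_mk_symmetricI reachable_trans)
  then show ?thesis
    using assms(1,2) by (auto simp: connected_graph_def Digraph_Component.connected_def strongly_connected_def)
qed

text \<open>A detour through \<open>w\<close> bounds every distance by 2, so only paths of lengths 0
  and 1 need to be characterised.\<close>

lemma graph_dist_dominating_vertex:
  assumes "pair_graph G" "w \<in> pverts G"
    and dom: "\<And>v. v \<in> pverts G \<Longrightarrow> v \<noteq> w \<Longrightarrow> (v, w) \<in> parcs G"
    and u: "u \<in> pverts G" and v: "v \<in> pverts G"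
  shows "graph_dist G u v = (if u = v then 0 else if (u, v) \<in> parcs G then 1 else 2)"
proof -
  interpret pair_graph G by fact
  define P where "P k \<longleftrightarrow> (\<exists>p. apath u p v \<and> length p = k)" for k
  have dist: "graph_dist G u v = (LEAST k. P k)"
    by (simp add: graph_dist_def P_def)
  have P0: "P 0 \<longleftrightarrow> u = v"
    using u by (auto simp: P_def apath_Nil_iff)
  have P1: "P 1 \<longleftrightarrow> (u, v) \<in> parcs G"
    using no_loops'
    by (auto simp: P_def length_Suc_conv apath_Cons_iff apath_Nil_iff in_arcsD2
        intro!: exI[of _ "[(u, v)]"])
  \<comment> \<open>An \<open>apath\<close> repeats no vertex, so \<open>w\<close> must differ from
    both ends; if it were one of them, dominance would make \<open>u\<close> and \<open>v\<close>
    adjacent.\<close>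
  have P2: "P 2" if "u \<noteq> v" "(u, v) \<notin> parcs G"
  proof -
    have "u \<noteq> w" "v \<noteq> w"
      using that dom u v by (auto dest: arcs_symmetric)
    then have "apath u [(u, w), (w, v)] v"
      using that u v dom by (auto simp: apath_Cons_iff apath_Nil_iff dest: arcs_symmetric)
    then show ?thesis
      unfolding P_def by (intro exI[of _ "[(u, w), (w, v)]"]) simp
  qed
  consider "u = v" | "u \<noteq> v" "(u, v) \<in> parcs G" | "u \<noteq> v" "(u, v) \<notin> parcs G" by blast
  then show ?thesis
  proof cases
    case 1
    then have "(LEAST k. P k) = 0"
      using P0 by (intro Least_equality) auto
    then show ?thesis using 1 dist by simp
  next
    case 2
    have "1 \<le> k" if "P k" for k
      using 2 P0 that by (cases k) auto
    then have "(LEAST k. P k) = 1"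
      using 2 P1 by (intro Least_equality) auto
    then show ?thesis using 2 by (simp add: dist)
  next
    case 3
    have "2 \<le> k" if "P k" for k
      using 3 P0 P1 that by (metis One_nat_def less_2_cases not_le)
    then have "(LEAST k. P k) = 2"
      by (intro Least_equality P2 3) auto
    then show ?thesis using 3 by (simp add: dist)
  qed
qed

section \<open>Isomorphisms\<close>

lemma graph_iso_refl:
  assumes "pair_graph G" shows "graph_iso G G"
proof -
  interpret pair_graph G by fact
  have "digraph_isomorphism \<lparr>iso_verts = id, iso_arcs = id, iso_head = snd, iso_tail = fst\<rparr>"
    by (auto simp: digraph_isomorphism_def wf_digraph_axioms)
  moreover have "with_proj G =
      app_iso \<lparr>iso_verts = id, iso_arcs = id, iso_head = snd, iso_tail = fst\<rparr> (with_proj G)"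
    by (simp add: app_iso_def with_proj_def)
  ultimately show ?thesis
    unfolding graph_iso_def digraph_iso_def by blast
qed

lemma graph_isoE:
  assumes "graph_iso G H"
  obtains f where "bij_betw f (pverts G) (pverts H)"
    and "\<And>u v. (u, v) \<in> parcs G \<Longrightarrow> (f u, f v) \<in> parcs H"
proof -
  obtain h where h: "pre_digraph.digraph_isomorphism (with_proj G) h"
    and H: "with_proj H = app_iso h (with_proj G)"
    using assms by (auto simp: graph_iso_def digraph_iso_def)
  \<comment> \<open>Both digraphs have \<open>fst\<close> and \<open>snd\<close> as tail and head,
    so the tail and head functions carried by \<open>h\<close> are these projections. Hence an arc
    is sent to the pair of images of its ends.\<close>
  have H': "pverts H = iso_verts h ` pverts G" "parcs H = iso_arcs h ` parcs G"
      "fst = iso_tail h" "snd = iso_head h"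
    using arg_cong[OF H, of verts] arg_cong[OF H, of arcs]
      arg_cong[OF H, of tail] arg_cong[OF H, of head] by simp_all
  show ?thesis
  proof
    show "bij_betw (iso_verts h) (pverts G) (pverts H)"
      using h H'(1) by (auto simp: bij_betw_def pre_digraph.digraph_isomorphism_def)
    fix u v assume uv: "(u, v) \<in> parcs G"
    then have "iso_verts h u = fst (iso_arcs h (u, v))" "iso_verts h v = snd (iso_arcs h (u, v))"
      using h unfolding H'(3,4) by (auto simp: pre_digraph.digraph_isomorphism_def)
    then show "(iso_verts h u, iso_verts h v) \<in> parcs H"
      using uv H'(2) by simp
  qed
qed

lemma graph_iso_card_eq: "graph_iso G H \<Longrightarrow> card (pverts G) = card (pverts H)"
  by (elim graph_isoE) (rule bij_betw_same_card)

section \<open>The Godsil--McKay matrix\<close>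

text \<open>For \<open>c\<close> invertible in the field, this acts on the first \<open>c\<close>
  coordinates as the reflection that fixes the all-ones vector and negates the vectors of sum
  zero.\<close>

definition gm_mat :: "nat \<Rightarrow> nat \<Rightarrow> 'k::field mat" where
  "gm_mat n c = mat n n (\<lambda>(i, j). (if i < c \<and> j < c then 2 / of_nat c else 0)
     + (if i = j then if i < c then -1 else 1 else 0))"

lemma gm_mat_carrier [simp]: "gm_mat n c \<in> carrier_mat n n"
  by (simp add: gm_mat_def)

lemma index_gm_mat_mult:
  fixes A :: "'k::field mat"
  assumes "A \<in> carrier_mat n n" "c \<le> n" "i < n" "j < n"
  shows "(gm_mat n c * A) $$ (i, j) =
    (if i < c then 2 / of_nat c * (\<Sum>k<c. A $$ (k, j)) - A $$ (i, j) else A $$ (i, j))"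
proof -
  have "(gm_mat n c * A) $$ (i, j) =
      (\<Sum>k<n. ((if i < c \<and> k < c then 2 / of_nat c else 0)
        + (if i = k then if i < c then -1 else 1 else 0)) * A $$ (k, j))"
    using assms by (simp add: gm_mat_def scalar_prod_def lessThan_atLeast0)
  also have "\<dots> = (\<Sum>k<n. if k < c then (if i < c then 2 / of_nat c * A $$ (k, j) else 0) else 0)
      + (\<Sum>k<n. if i = k then (if i < c then - A $$ (k, j) else A $$ (k, j)) else 0)"
    by (subst sum.distrib[symmetric], rule sum.cong) (auto simp: algebra_simps)
  also have "(\<Sum>k<n. if k < c then (if i < c then 2 / of_nat c * A $$ (k, j) else 0) else 0)
      = (\<Sum>k<c. if i < c then 2 / of_nat c * A $$ (k, j) else 0)"
    using assms(2) by (intro sum.mono_neutral_cong_right) auto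
  finally show ?thesis
    using assms by (simp add: sum_distrib_left)
qed

text \<open>The matrix is symmetric, so transposition reduces this to left multiplication.\<close>

lemma index_mult_gm_mat:
  fixes A :: "'k::field mat"
  assumes "A \<in> carrier_mat n n" "c \<le> n" "i < n" "j < n"
  shows "(A * gm_mat n c) $$ (i, j) =
    (if j < c then 2 / of_nat c * (\<Sum>k<c. A $$ (i, k)) - A $$ (i, j) else A $$ (i, j))"
proof -
  have "transpose_mat (gm_mat n c :: 'k mat) = gm_mat n c"
    by (rule eq_matI) (auto simp: gm_mat_def)
  then have "(A * gm_mat n c) $$ (i, j) = (gm_mat n c * transpose_mat A) $$ (j, i)"
    using assms transpose_mult[of A n n "gm_mat n c" n]
      index_transpose_mat(1)[of j "A * gm_mat n c" i] by (simp add: gm_mat_def)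
  then show ?thesis
    using assms by (simp add: index_gm_mat_mult)
qed

text \<open>A column of the leading block has sum \<open>2 - 1 = 1\<close>, so reflecting it gives
  \<open>2 / c\<close> minus each entry, which is a column of the identity.\<close>

lemma gm_mat_mult_self:
  assumes "c \<le> n" "of_nat c \<noteq> (0 :: 'k::field)"
  shows "gm_mat n c * gm_mat n c = (1\<^sub>m n :: 'k mat)"
proof (rule eq_matI)
  fix i j assume "i < dim_row (1\<^sub>m n :: 'k mat)" "j < dim_col (1\<^sub>m n :: 'k mat)"
  then have ij: "i < n" "j < n" by simp_all
  have "(\<Sum>k<c. gm_mat n c $$ (k, j)) =
      (\<Sum>k<c. if j < c then 2 / of_nat c else 0) + (\<Sum>k<c. if k = j then -1 else 0 :: 'k)"
    using assms(1) ij by (subst sum.distrib[symmetric], intro sum.cong) (auto simp: gm_mat_def)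
  then have "(\<Sum>k<c. gm_mat n c $$ (k, j)) = (if j < c then 1 else 0 :: 'k)"
    using assms(2) by (simp add: sum.delta)
  then show "(gm_mat n c * gm_mat n c) $$ (i, j) = (1\<^sub>m n :: 'k mat) $$ (i, j)"
    using assms(1) ij by (simp add: index_gm_mat_mult) (simp add: gm_mat_def)
qed (auto simp: gm_mat_def)

lemma sum_mat_eq_sum:
  assumes "A \<in> carrier_mat n m"
  shows "sum_mat A = (\<Sum>i<n. \<Sum>j<m. A $$ (i, j))"
    and "sum_mat A = (\<Sum>j<m. \<Sum>i<n. A $$ (i, j))"
proof -
  show "sum_mat A = (\<Sum>i<n. \<Sum>j<m. A $$ (i, j))"
    using assms by (simp add: sum_mat_def sum.cartesian_product lessThan_atLeast0)
  then show "sum_mat A = (\<Sum>j<m. \<Sum>i<n. A $$ (i, j))"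
    by (simp only: sum.swap[of _ "{..<m}"])
qed

text \<open>Every column sum is preserved: if the first \<open>c\<close> entries of a column add up
  to \<open>s\<close>, their reflections add up to \<open>2 * s - s\<close>.\<close>

lemma sum_gm_mat_mult:
  fixes A :: "'k::field mat"
  assumes A: "A \<in> carrier_mat n n" and c: "c \<le> n" "of_nat c \<noteq> (0 :: 'k)"
  shows "sum_mat (gm_mat n c * A) = sum_mat A"
proof -
  have "(\<Sum>i<n. (gm_mat n c * A) $$ (i, j)) = (\<Sum>i<n. A $$ (i, j))" if j: "j < n" for j
  proof -
    let ?s = "\<Sum>k<c. A $$ (k, j)"
    have split: "(\<Sum>i<n. g i) = (\<Sum>i<c. g i) + (\<Sum>i\<in>{c..<n}. g i)" for g :: "nat \<Rightarrow> 'k"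
      using c(1) by (simp add: lessThan_atLeast0 sum.atLeastLessThan_concat)
    have "(\<Sum>i<c. (gm_mat n c * A) $$ (i, j)) = (\<Sum>i<c. 2 / of_nat c * ?s - A $$ (i, j))"
      using A c j by (intro sum.cong) (auto simp: index_gm_mat_mult)
    also have "\<dots> = of_nat c * (2 / of_nat c * ?s) - ?s"
      by (simp only: sum_subtractf sum_constant card_lessThan)
    also have "\<dots> = 2 * ?s - ?s"
      using c(2) by simp
    also have "\<dots> = ?s"
      by (simp only: mult_2 add_diff_cancel_right')
    finally have "(\<Sum>i<c. (gm_mat n c * A) $$ (i, j)) = ?s" .
    moreover have "(\<Sum>i\<in>{c..<n}. (gm_mat n c * A) $$ (i, j)) = (\<Sum>i\<in>{c..<n}. A $$ (i, j))"
      using A c j by (intro sum.cong) (auto simp: index_gm_mat_mult)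
    ultimately show ?thesis
      by (simp only: split)
  qed
  moreover have "gm_mat n c * A \<in> carrier_mat n n"
    using A by (rule mult_carrier_mat[OF gm_mat_carrier])
  ultimately show ?thesis
    using A by (simp add: sum_mat_eq_sum(2))
qed

lemma sum_mult_gm_mat:
  fixes A :: "'k::field mat"
  assumes A: "A \<in> carrier_mat n n" and c: "c \<le> n" "of_nat c \<noteq> (0 :: 'k)"
  shows "sum_mat (A * gm_mat n c) = sum_mat A"
proof -
  have sum_transpose: "sum_mat (transpose_mat B) = sum_mat B" if "B \<in> carrier_mat n n" for B :: "'k mat"
    using that sum_mat_eq_sum(1)[of "transpose_mat B" n n] sum_mat_eq_sum(2)[of B n n] by simp
  have "transpose_mat (gm_mat n c :: 'k mat) = gm_mat n c"
    by (rule eq_matI) (auto simp: gm_mat_def)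
  then have "transpose_mat (A * gm_mat n c) = gm_mat n c * transpose_mat A"
    using A by (simp add: transpose_mult[OF A gm_mat_carrier])
  then show ?thesis
    using sum_transpose[of "A * gm_mat n c"] sum_transpose[OF A] sum_gm_mat_mult[of "transpose_mat A" n c] A c
    by simp
qed

section \<open>Invariants of matrices intertwined by the Godsil--McKay matrix\<close>

lemma gm_conjugate:
  fixes A B :: "'k::field mat"
  assumes A: "A \<in> carrier_mat n n" and B: "B \<in> carrier_mat n n"
    and c: "c \<le> n" "of_nat c \<noteq> (0 :: 'k)" and eq: "gm_mat n c * A = B * gm_mat n c"
  shows "A = gm_mat n c * B * gm_mat n c"
proof -
  have "gm_mat n c * B * gm_mat n c = gm_mat n c * (gm_mat n c * A)"
    using B by (simp add: eq assoc_mult_mat[OF gm_mat_carrier B gm_mat_carrier])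
  also have "\<dots> = A"
    using A c gm_mat_mult_self[OF c] by (simp flip: assoc_mult_mat[OF gm_mat_carrier gm_mat_carrier A])
  finally show ?thesis by simp
qed

lemma gm_char_poly:
  fixes A B :: "'k::field mat"
  assumes A: "A \<in> carrier_mat n n" and B: "B \<in> carrier_mat n n"
    and c: "c \<le> n" "of_nat c \<noteq> (0 :: 'k)" and eq: "gm_mat n c * A = B * gm_mat n c"
  shows "char_poly A = char_poly B"
proof (rule char_poly_similar)
  have "similar_mat_wit A B (gm_mat n c) (gm_mat n c)"
    using A B gm_conjugate[OF assms] gm_mat_mult_self[OF c]
    by (auto simp: similar_mat_wit_def Let_def carrier_matD[OF gm_mat_carrier])
  then show "similar_mat A B" by (auto simp: similar_mat_def)
qed

lemma gm_mat_inverse: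
  fixes A B :: "'k::field mat"
  assumes A: "A \<in> carrier_mat n n" and B: "B \<in> carrier_mat n n"
    and c: "c \<le> n" "of_nat c \<noteq> (0 :: 'k)" and eq: "gm_mat n c * A = B * gm_mat n c"
    and inv: "mat_inverse A = Some Y"
  shows "mat_inverse B = Some (gm_mat n c * Y * gm_mat n c)"
proof -
  let ?S = "gm_mat n c :: 'k mat"
  note S = gm_mat_carrier[of n c]
  note SS = gm_mat_mult_self[OF c]
  have Y: "Y \<in> carrier_mat n n" "A * Y = 1\<^sub>m n" "Y * A = 1\<^sub>m n"
    using mat_inverse(2)[OF A inv] by auto
  have W: "?S * Y * ?S \<in> carrier_mat n n"
    using Y(1) by (intro mult_carrier_mat[of _ n n]) auto
  have "B * (?S * Y * ?S) = (B * ?S) * (Y * ?S)"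
    using B Y S by (simp add: assoc_mult_mat[of _ n n _ n _ n] mult_carrier_mat[of _ n n])
  also have "\<dots> = ?S * (A * Y) * ?S"
    using A Y(1) S by (simp add: eq[symmetric] assoc_mult_mat[of _ n n _ n _ n] mult_carrier_mat[of _ n n])
  also have "\<dots> = 1\<^sub>m n"
    using Y SS by (simp add: right_mult_one_mat[OF S])
  finally have right: "B * (?S * Y * ?S) = 1\<^sub>m n" .
  then have left: "(?S * Y * ?S) * B = 1\<^sub>m n"
    using mat_mult_left_right_inverse[OF B W] by blast
  \<comment> \<open>\<open>mat_inverse\<close> yields a result once \<open>B\<close> is known to be
    a unit; uniqueness of inverses then identifies it.\<close>
  have "B \<in> Units (ring_mat TYPE('k) n ())"
    using B W left right by (auto simp: Units_def ring_mat_def)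
  then obtain X where X: "mat_inverse B = Some X"
    using mat_inverse(1)[OF B, of "()"] by (cases "mat_inverse B") auto
  have X': "B * X = 1\<^sub>m n" "X * B = 1\<^sub>m n" "X \<in> carrier_mat n n"
    using mat_inverse(2)[OF B X] by auto
  have "X = X * (B * (?S * Y * ?S))"
    using right X'(3) by simp
  also have "\<dots> = X * B * (?S * Y * ?S)"
    by (rule assoc_mult_mat[OF X'(3) B W, symmetric])
  also have "\<dots> = ?S * Y * ?S"
    using X'(2) W by (simp add: left_mult_one_mat[OF W])
  finally show ?thesis using X by simp
qed

lemma gm_sum_mat_inverse:
  fixes A B :: "'k::field mat"
  assumes A: "A \<in> carrier_mat n n" and B: "B \<in> carrier_mat n n"
    and c: "c \<le> n" "of_nat c \<noteq> (0 :: 'k)" and eq: "gm_mat n c * A = B * gm_mat n c"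
  shows "sum_mat (the (mat_inverse A)) = sum_mat (the (mat_inverse B))"
proof (cases "mat_inverse A")
  case (Some Y)
  then have "mat_inverse B = Some (gm_mat n c * Y * gm_mat n c)"
    by (rule gm_mat_inverse[OF assms])
  moreover have "Y \<in> carrier_mat n n"
    using mat_inverse(2)[OF A Some] by auto
  ultimately show ?thesis
    using Some c by (simp add: sum_mult_gm_mat sum_gm_mat_mult mult_carrier_mat[of _ n n])
next
  case None
  \<comment> \<open>The intertwiner is an involution, so the relation also holds with
    \<open>A\<close> and \<open>B\<close> exchanged. An inverse of \<open>B\<close> would therefore
    give one of \<open>A\<close>, and both sides of the goal are sums of
    \<open>the None\<close>.\<close>
  have "gm_mat n c * B = A * gm_mat n c"
  proof -
    have "A * gm_mat n c = gm_mat n c * B * (gm_mat n c * gm_mat n c)"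
      using A B gm_conjugate[OF assms]
        assoc_mult_mat[of "gm_mat n c * B" n n "gm_mat n c" n "gm_mat n c" n]
      by (simp add: mult_carrier_mat[of _ n n])
    then show ?thesis
      using B gm_mat_mult_self[OF c]
      by (simp add: right_mult_one_mat[of _ n n] mult_carrier_mat[of _ n n])
  qed
  then have "mat_inverse B = None"
    using gm_mat_inverse[OF B A c] None by (cases "mat_inverse B") auto
  with None show ?thesis by simp
qed

text \<open>The intertwiner mixes only the first \<open>c\<close> rows, so it commutes with a row
  scaling whose factors agree there. With row sums as \<open>r\<close>, this passes from similarity
  to transition matrices.\<close>

lemma gm_scale_rows:
  fixes A B :: "'k::field mat"
  assumes A: "A \<in> carrier_mat n n" and B: "B \<in> carrier_mat n n" and c: "c \<le> n"
    and eq: "gm_mat n c * A = B * gm_mat n c" and r: "\<And>i. i < c \<Longrightarrow> r i = r 0"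
  shows "gm_mat n c * mat n n (\<lambda>(i, j). A $$ (i, j) / r i) =
    mat n n (\<lambda>(i, j). B $$ (i, j) / r i) * gm_mat n c" (is "_ * ?A = ?B * _")
proof (rule eq_matI)
  fix i j assume "i < dim_row (?B * gm_mat n c)" "j < dim_col (?B * gm_mat n c)"
  then have ij: "i < n" "j < n" by (auto simp: gm_mat_def)
  have "(gm_mat n c * ?A) $$ (i, j) = (gm_mat n c * A) $$ (i, j) / r i"
  proof (cases "i < c")
    case True
    have "r k = r i" if "k < c" for k
      using r[OF that] r[OF True] by simp
    then have "(\<Sum>k<c. A $$ (k, j) / r k) = (\<Sum>k<c. A $$ (k, j)) / r i"
      unfolding sum_divide_distrib by (intro sum.cong refl) (metis lessThan_iff)
    then show ?thesis
      using True ij A c by (simp add: index_gm_mat_mult diff_divide_distrib)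
  qed (use ij A c in \<open>simp add: index_gm_mat_mult\<close>)
  moreover have "(?B * gm_mat n c) $$ (i, j) = (B * gm_mat n c) $$ (i, j) / r i"
    using ij B c by (simp add: index_mult_gm_mat diff_divide_distrib flip: sum_divide_distrib)
  ultimately show "(gm_mat n c * ?A) $$ (i, j) = (?B * gm_mat n c) $$ (i, j)"
    by (simp add: eq)
qed (auto simp: gm_mat_def)

section \<open>The family of pairs\<close>

text \<open>
  The switching set is \<open>{0, 1, 2, 3}\<close>, vertex 10 is dominating, and from 11 on there are only
  pendant vertices. All six of its two-element subsets are needed as
  neighbourhoods: if only two of the three partitions into pairs occurred, an element of the
  Klein four-group would undo the switching.
\<close>

definition attachments :: "bool \<Rightarrow> (nat \<times> nat) set" where
  "attachments b = (if b
     then {(4,0), (4,1), (5,0), (5,2), (6,0), (6,3), (7,2), (7,3), (8,1), (8,3), (9,1), (9,2)}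
     else {(4,2), (4,3), (5,1), (5,3), (6,1), (6,2), (7,0), (7,1), (8,0), (8,2), (9,0), (9,3)})"

text \<open>The triangle on 4, 5, 6 tells the two graphs apart: its vertices share the neighbour 0
  in the switching set for \<open>True\<close>, but share none there for \<open>False\<close>.
  Without it, exchanging 4 with 7, 5 with 8 and 6 with 9 would undo the switching.\<close>

definition adjacent :: "bool \<Rightarrow> nat \<Rightarrow> nat \<Rightarrow> bool" where
  "adjacent b u v \<longleftrightarrow> u \<noteq> v \<and> (u = 10 \<or> v = 10 \<or> {u, v} \<subseteq> {4, 5, 6} \<or>
     (u, v) \<in> attachments b \<or> (v, u) \<in> attachments b)"

definition gm_graph :: "nat \<Rightarrow> bool \<Rightarrow> nat pair_pre_digraph" where
  "gm_graph m b = \<lparr>pverts = {..<11 + m},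
     parcs = {(u, v). u < 11 + m \<and> v < 11 + m \<and> adjacent b u v}\<rparr>"

lemma pverts_gm_graph [simp]: "pverts (gm_graph m b) = {..<11 + m}"
  by (simp add: gm_graph_def)

lemma parcs_gm_graph:
  "(u, v) \<in> parcs (gm_graph m b) \<longleftrightarrow> u < 11 + m \<and> v < 11 + m \<and> adjacent b u v"
  by (simp add: gm_graph_def)

lemma pair_graph_gm_graph: "pair_graph (gm_graph m b)"
proof
  have "finite ({..<11 + m} \<times> {..<11 + m})" by simp
  then show "finite (parcs (gm_graph m b))"
    by (rule finite_subset[rotated]) (auto simp: gm_graph_def)
  show "symmetric (with_proj (gm_graph m b))"
    by (auto simp: symmetric_def sym_def parcs_gm_graph adjacent_def)
qed (auto simp: gm_graph_def adjacent_def)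

lemma gm_graph_dominating_vertex:
  "10 \<in> pverts (gm_graph m b)"
  "\<And>v. v \<in> pverts (gm_graph m b) \<Longrightarrow> v \<noteq> 10 \<Longrightarrow> (v, 10) \<in> parcs (gm_graph m b)"
  by (auto simp: parcs_gm_graph adjacent_def)

lemma connected_gm_graph: "connected_graph (gm_graph m b)"
  by (rule dominating_vertex_connected[OF pair_graph_gm_graph gm_graph_dominating_vertex])

text \<open>One graph contains a clique of five vertices, whereas the other is 4-colourable.\<close>

lemma not_iso_gm_graph: "\<not> graph_iso (gm_graph m True) (gm_graph m False)"
proof
  assume "graph_iso (gm_graph m True) (gm_graph m False)"
  then obtain f where f: "\<And>u v. (u, v) \<in> parcs (gm_graph m True) \<Longrightarrow>
      (f u, f v) \<in> parcs (gm_graph m False)"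
    using graph_isoE by metis
  \<comment> \<open>The dominating vertex has colour 0 to itself. Each other class joins vertices of
    the switching set to attached vertices not adjacent to them; pendant vertices get colour
    1.\<close>
  define col :: "nat \<Rightarrow> nat" where
    "col v = (if v \<in> {2, 5, 7, 9} then 2 else if v \<in> {3, 6, 8} then 3
       else if v = 10 then 0 else 1)" for v
  have "col u \<noteq> col v" if "(u, v) \<in> attachments False" for u v
    using that by (auto simp: attachments_def col_def)
  moreover have "col u \<noteq> col v" if "{u, v} \<subseteq> {4, 5, 6}" "u \<noteq> v" for u v
    using that by (auto simp: col_def)
  moreover have "col u = 0 \<longleftrightarrow> u = 10" for u
    by (simp add: col_def)
  ultimately have col: "col u \<noteq> col v" if "adjacent False u v" for u v
    using that unfolding adjacent_def by metis
  \<comment> \<open>These five vertices form a clique for \<open>True\<close>: the triangle, its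
    common neighbour 0 and the dominating vertex. Pulling the colouring back along \<open>f\<close>
    separates them.\<close>
  have "inj_on (col \<circ> f) {0, 4, 5, 6, 10}"
  proof (rule inj_onI, rule ccontr)
    fix u v :: nat
    assume uv: "u \<in> {0, 4, 5, 6, 10}" "v \<in> {0, 4, 5, 6, 10}" "u \<noteq> v"
      and eq: "(col \<circ> f) u = (col \<circ> f) v"
    have "(u, v) \<in> parcs (gm_graph m True)"
      using uv by (elim insertE emptyE; simp add: parcs_gm_graph adjacent_def attachments_def)
    then show False
      using f[of u v] col[of "f u" "f v"] eq by (simp add: parcs_gm_graph)
  qed
  moreover have "col v < 4" for v
    by (simp add: col_def)
  then have "(col \<circ> f) ` {0, 4, 5, 6, 10} \<subseteq> {..<4}"
    by auto
  ultimately have "card {0, 4, 5, 6, 10 :: nat} \<le> card {..<4 :: nat}"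
    by (rule card_inj_on_le) simp
  then show False by simp
qed

section \<open>Closed form of the similarity matrices\<close>

definition weight :: "'k::field \<Rightarrow> bool \<Rightarrow> nat \<Rightarrow> nat \<Rightarrow> 'k" where
  "weight q b i j = (if i = j then 1 else if adjacent b i j then q else q\<^sup>2)"

lemma power_graph_dist_gm_graph:
  assumes "i < 11 + m" "j < 11 + m"
  shows "q ^ graph_dist (gm_graph m b) (vertex (gm_graph m b) i) (vertex (gm_graph m b) j) =
    weight q b i j"
proof -
  \<comment> \<open>The vertices form an initial segment of the naturals, so their increasing
    enumeration is the identity.\<close>
  have "vertex (gm_graph m b) k = k" if "k < 11 + m" for k
    using that sorted_list_of_set_range[of 0 "11 + m"]
    by (simp add: vertex_def lessThan_atLeast0)
  then show ?thesis
    using assms graph_dist_dominating_vertex[OF pair_graph_gm_graph gm_graph_dominating_vertex]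
    by (simp add: weight_def parcs_gm_graph)
qed

lemma similarity_matrix_gm_graph:
  "similarity_matrix (gm_graph m b) q = mat (11 + m) (11 + m) (\<lambda>(i, j). weight q b i j)"
  unfolding similarity_matrix_def by (rule eq_matI) (auto simp: power_graph_dist_gm_graph)

lemma lessThan_11: "{..<11 :: nat} = {0, 1, 2, 3, 4, 5, 6, 7, 8, 9, 10}"
  by (auto simp: lessThan_nat_numeral)

lemma less_10_cases:
  "i < 10 \<Longrightarrow> i = 0 \<or> i = 1 \<or> i = 2 \<or> i = 3 \<or> i = 4 \<or> i = 5 \<or> i = 6 \<or> i = 7 \<or> i = 8 \<or> i = (9::nat)"
  by presburger

lemma attachments_bounds: "(i, j) \<in> attachments b \<Longrightarrow> 4 \<le> i \<and> i < 10 \<and> j < 4"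
  by (auto simp: attachments_def split: if_splits)

lemma weight_ge_10:
  assumes "10 \<le> i \<or> 10 \<le> j"
  shows "weight q b i j = (if i = j then 1 else if i = 10 \<or> j = 10 then q else q\<^sup>2)"
proof -
  have "(i, j) \<notin> attachments b" "(j, i) \<notin> attachments b" "\<not> {i, j} \<subseteq> {4, 5, 6}"
    using assms by (auto dest: attachments_bounds)
  then show ?thesis
    by (simp add: weight_def adjacent_def del: insert_subset)
qed

lemma weight_ge_4:
  assumes "4 \<le> i" "4 \<le> j"
  shows "weight q True i j = weight q False i j"
proof -
  have "(i, j) \<notin> attachments b" "(j, i) \<notin> attachments b" for b
    using assms by (auto dest: attachments_bounds)
  then show ?thesis
    by (simp add: weight_def adjacent_def del: insert_subset)
qed

lemma weight_less_4:
  assumes "i < 4" "j < 4"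
  shows "weight q b i j = (if i = j then 1 else q\<^sup>2)"
proof -
  have "(i, j) \<notin> attachments b" "(j, i) \<notin> attachments b" "\<not> {i, j} \<subseteq> {4, 5, 6}"
    using assms by (auto dest: attachments_bounds)
  then show ?thesis
    using assms by (simp add: weight_def adjacent_def del: insert_subset)
qed

lemma weight_commute: "weight q b i j = weight q b j i"
  by (auto simp: weight_def adjacent_def insert_commute simp del: insert_subset)

section \<open>Block sums, row sums and the switching relation\<close>

lemma lessThan_4: "{..<4 :: nat} = {0, 1, 2, 3}"
  by (auto simp: lessThan_nat_numeral)

lemma less_4_cases: "i < 4 \<Longrightarrow> i = 0 \<or> i = 1 \<or> i = 2 \<or> i = (3::nat)"
  by presburger

lemma between_4_10_cases:
  "4 \<le> i \<Longrightarrow> i < 10 \<Longrightarrow> i = 4 \<or> i = 5 \<or> i = 6 \<or> i = 7 \<or> i = 8 \<or> i = (9::nat)"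
  by presburger

lemma sum_weight_attached:
  assumes "4 \<le> j" "j < 10"
  shows "(\<Sum>k<4. weight q b k j) = 2 * (q + q\<^sup>2)"
  using between_4_10_cases[OF assms]
  by (elim disjE; cases b) (simp_all add: lessThan_4 weight_def adjacent_def attachments_def)

text \<open>Switching turns distance 1 into 2 and conversely between an attached vertex and the
  switching set.\<close>

lemma weight_attached:
  assumes "i < 4" "4 \<le> j" "j < 10"
  shows "weight q True i j + weight q False i j = q + q\<^sup>2"
  using less_4_cases[OF assms(1)] between_4_10_cases[OF assms(2,3)]
  by (elim disjE) (simp_all add: weight_def adjacent_def attachments_def)

lemma sum_weight_less_4:
  assumes "j < 4"
  shows "(\<Sum>k<4. weight q b k j) = 1 + 3 * q\<^sup>2"
  using less_4_cases[OF assms] by (elim disjE) (simp_all add: lessThan_4 weight_less_4)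

lemma row_sum_weight:
  "(\<Sum>j<11 + m. weight q b i j) = (\<Sum>j<11. weight q b i j) + (\<Sum>j<m. weight q b i (11 + j))"
  by (induction m) (simp, simp only: add_Suc_right sum.lessThan_Suc add.assoc)

text \<open>As distances are at most 2, row sums depend only on degrees. An attached vertex keeps
  two neighbours in the switching set, and a vertex there keeps three attached neighbours.\<close>

lemma row_sum_weight_switch:
  "(\<Sum>j<11 + m. weight q False i j) = (\<Sum>j<11 + m. weight q True i j)"
proof (cases "i < 10")
  case True
  have "(\<Sum>j<11. weight q False i j) = (\<Sum>j<11. weight q True i j)"
    using less_10_cases[OF True]
    by (elim disjE) (simp_all add: lessThan_11 weight_def adjacent_def attachments_def)
  then show ?thesis by (simp add: row_sum_weight weight_ge_10)
qed (simp add: weight_ge_10)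

text \<open>Each vertex of the switching set lies in three of its six two-element subsets, so all
  four have equal degree.\<close>

lemma row_sum_weight_constant:
  assumes "i < 4"
  shows "(\<Sum>j<11 + m. weight q True i j) = (\<Sum>j<11 + m. weight q True 0 j)"
proof -
  have i: "i = 0 \<or> i = 1 \<or> i = 2 \<or> i = 3" using assms by linarith
  have "(\<Sum>j<11. weight q True i j) = (\<Sum>j<11. weight q True 0 j)"
    using i by (elim disjE) (simp_all add: lessThan_11 weight_def adjacent_def attachments_def)
  moreover have "weight q True i (11 + j) = weight q True 0 (11 + j)" for j
    using i by (elim disjE) (simp_all add: weight_def adjacent_def attachments_def)
  ultimately show ?thesis by (simp only: row_sum_weight)
qed

text \<open>Blockwise: on the switching set both matrices are the same combination of the identity
  and the all-ones matrix, which commutes with the reflection; outside it they agree; the mixed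
  blocks are exchanged by reflecting.\<close>

lemma gm_switching:
  fixes q :: "'k::field_char_0"
  shows "gm_mat (11 + m) 4 * similarity_matrix (gm_graph m True) q =
    similarity_matrix (gm_graph m False) q * gm_mat (11 + m) 4"
proof (rule eq_matI)
  let ?n = "11 + m"
  fix i j
  assume "i < dim_row (similarity_matrix (gm_graph m False) q * gm_mat ?n 4)"
    "j < dim_col (similarity_matrix (gm_graph m False) q * gm_mat ?n 4)"
  then have ij: "i < ?n" "j < ?n" by (auto simp: similarity_matrix_def gm_mat_def)
  have key: "(if i < 4 then (\<Sum>k<4. weight q True k j) / 2 - weight q True i j else weight q True i j) =
     (if j < 4 then (\<Sum>k<4. weight q False i k) / 2 - weight q False i j else weight q False i j)"
  proof -
    \<comment> \<open>For an attached vertex \<open>v\<close>, half the sum is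
      \<open>q + q\<^sup>2\<close>, so the subtraction swaps \<open>q\<close> and
      \<open>q\<^sup>2\<close>. From 10 on, the entries are constant over the switching set and
      reflection fixes them.\<close>
    have attached: "(\<Sum>k<4. weight q b k v) / 2 - weight q b u v = weight q (\<not> b) u v"
      if "u < 4" "4 \<le> v" for b u v
    proof (cases "v < 10")
      case True
      then show ?thesis
        using that weight_attached[of u v q]
        by (cases b) (simp_all add: sum_weight_attached eq_diff_eq diff_eq_eq add.commute)
    next
      case False
      then show ?thesis
        using that by (simp add: lessThan_4 weight_ge_10)
    qed
    have commute: "(\<Sum>k<4. weight q b i k) = (\<Sum>k<4. weight q b k i)" for b
      by (simp only: weight_commute[of q b i])
    consider "i < 4" "j < 4" | "i < 4" "4 \<le> j" | "4 \<le> i" "j < 4" | "4 \<le> i" "4 \<le> j"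
      by linarith
    then show ?thesis
    proof cases
      case 1
      then show ?thesis
        by (simp add: commute sum_weight_less_4 weight_less_4[OF 1])
    next
      case 2
      then show ?thesis
        using attached[of i j True] by simp
    next
      case 3
      then show ?thesis
        using attached[of j i False] by (simp add: commute weight_commute[of _ _ j i])
    next
      case 4
      then show ?thesis
        by (simp add: weight_ge_4)
    qed
  qed
  have "(gm_mat ?n 4 * similarity_matrix (gm_graph m True) q) $$ (i, j) =
      (if i < 4 then (\<Sum>k<4. weight q True k j) / 2 - weight q True i j else weight q True i j)"
    using ij by (simp add: similarity_matrix_gm_graph index_gm_mat_mult)
  moreover have "(similarity_matrix (gm_graph m False) q * gm_mat ?n 4) $$ (i, j) =
      (if j < 4 then (\<Sum>k<4. weight q False i k) / 2 - weight q False i j else weight q False i j)"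
    using ij by (simp add: similarity_matrix_gm_graph index_mult_gm_mat)
  ultimately show "(gm_mat ?n 4 * similarity_matrix (gm_graph m True) q) $$ (i, j) =
      (similarity_matrix (gm_graph m False) q * gm_mat ?n 4) $$ (i, j)"
    using key by simp
qed (auto simp: similarity_matrix_def gm_mat_def)

section \<open>Equality of the three invariants\<close>

lemma similarity_matrix_carrier [simp]: "similarity_matrix (gm_graph m b) q \<in> carrier_mat (11 + m) (11 + m)"
  by (simp add: similarity_matrix_gm_graph)

lemma identical_q_spectra_gm_graph:
  "identical_q_spectra (gm_graph m True) (gm_graph m False)"
  unfolding identical_q_spectra_def q_spectrum_def eigenvalue_mset_def
  by (intro ballI arg_cong[of _ _ proots] gm_char_poly[OF _ _ _ _ gm_switching]) simp_all

lemma identical_transition_q_spectra_gm_graph: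
  "identical_transition_q_spectra (gm_graph m True) (gm_graph m False)"
proof -
  let ?n = "11 + m"
  \<comment> \<open>For complex \<open>q\<close> a row sum may vanish; division by zero then gives a
    zero row, and row scaling still applies.\<close>
  have "char_poly (transition_matrix (gm_graph m True) q) =
      char_poly (transition_matrix (gm_graph m False) q)" for q :: complex
  proof -
    \<comment> \<open>The row sums for \<open>True\<close> serve both graphs, since switching
      preserves them.\<close>
    define r where "r i = (\<Sum>j<?n. weight q True i j)" for i
    have transition: "transition_matrix (gm_graph m b) q =
        mat ?n ?n (\<lambda>(i, j). similarity_matrix (gm_graph m b) q $$ (i, j) / r i)" for b
      unfolding transition_matrix_def
      by (rule eq_matI; cases b)
        (auto simp: power_graph_dist_gm_graph similarity_matrix_gm_graph r_def row_sum_weight_switch)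
    have r: "r i = r 0" if "i < 4" for i
      unfolding r_def using row_sum_weight_constant[OF that] .
    show ?thesis
      unfolding transition
      by (rule gm_char_poly[OF _ _ _ _
            gm_scale_rows[where r = r, OF similarity_matrix_carrier similarity_matrix_carrier _ gm_switching r]]) auto
  qed
  then show ?thesis
    by (simp add: identical_transition_q_spectra_def transition_q_spectrum_def eigenvalue_mset_def)
qed

text \<open>The switching relation is used here over the field of rational functions, with
  \<open>q\<close> the indeterminate.\<close>

lemma formal_magnitude_gm_graph:
  "formal_magnitude (gm_graph m True) = formal_magnitude (gm_graph m False)"
  unfolding formal_magnitude_def
  by (rule gm_sum_mat_inverse[OF _ _ _ _ gm_switching]) simp_all

theorem corollary5p2:
  shows "infinite {{iso_class G, iso_class G'} | G G' :: nat pair_pre_digraph.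
    connected_graph G \<and> connected_graph G' \<and> \<not> graph_iso G G' \<and>
    identical_transition_q_spectra G G' \<and>
    identical_q_spectra G G' \<and>
    formal_magnitude G = formal_magnitude G'}" (is "infinite ?X")
proof -
  define F where "F m = {iso_class (gm_graph m True), iso_class (gm_graph m False)}" for m
  have "inj F"
  proof (rule injI)
    fix m k assume "F m = F k"
    \<comment> \<open>An unordered pair does not record which member is which, so only an
      isomorphism with one of the two graphs for \<open>k\<close> results. Both have
      \<open>11 + k\<close> vertices, which determines \<open>k\<close>.\<close>
    then have "iso_class (gm_graph m True) \<in> F k" by (auto simp: F_def)
    moreover have "gm_graph m True \<in> iso_class (gm_graph m True)"
      by (simp add: iso_class_def connected_gm_graph graph_iso_refl pair_graph_gm_graph)
    ultimately obtain b where "graph_iso (gm_graph k b) (gm_graph m True)"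
      by (auto simp: F_def iso_class_def)
    from graph_iso_card_eq[OF this] show "m = k" by simp
  qed
  moreover have "range F \<subseteq> ?X"
    unfolding F_def using connected_gm_graph not_iso_gm_graph
      identical_transition_q_spectra_gm_graph identical_q_spectra_gm_graph formal_magnitude_gm_graph
    by blast
  ultimately show ?thesis
    using range_inj_infinite finite_subset by blast
qed

end
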